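(* Let $G$ be a graph. Then $\mathcal{R}(G\vee K_1)\cong \mathcal{R}(G)\vee K_1$.
   Context: All graphs are finite, simple and undirected; $N(v)$ denotes the open neighbourhood of $v$. A set $S\subseteq V(G)$ is a dominating set if every vertex of $G$ is in $S$ or adjacent to a vertex of $S$; it is a minimal dominating set if no proper subset of $S$ is a dominating set. The reconfiguration graph $\mathcal{R}(G)$ has as vertex set the collection of all minimal dominating sets of $G$, and two minimal dominating sets $M_1,M_2$ are adjacent iff there is a vertex $v$ with either ($M_2\setminus M_1=\{v\}$ and $M_1\setminus M_2\subseteq N(v)$) or ($M_1\setminus M_2=\{v\}$ and $M_2\setminus M_1\subseteq N(v)$). The join $A\vee B$ is the disjoint union of $A$ and $B$ together with all edges between $V(A)$ and $V(B)$.
   Formalization: The graph G is assumed to have at least one vertex; for the graph with no vertices the claim fails, since R(G ∨ K_1) has one vertex while R(G) ∨ K_1 has two. *)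

theory Defs
  imports "Graph_Theory.Graph_Theory"
begin

text \<open>
  Finite simple undirected graphs are represented by the locale \<^locale>\<open>pair_graph\<close>: finite,
  loop-free digraphs without parallel arcs whose arc relation is symmetric, an undirected edge
  being the pair of its two orientations.
\<close>

definition open_nbhd :: "'a pair_pre_digraph \<Rightarrow> 'a \<Rightarrow> 'a set" where
  "open_nbhd G v = {w. (v, w) \<in> parcs G}"

definition dominating_set :: "'a pair_pre_digraph \<Rightarrow> 'a set \<Rightarrow> bool" where
  "dominating_set G S \<longleftrightarrow>
     S \<subseteq> pverts G \<and> (\<forall>v \<in> pverts G. v \<in> S \<or> (\<exists>u \<in> S. (v, u) \<in> parcs G))"

definition minimal_dominating_set :: "'a pair_pre_digraph \<Rightarrow> 'a set \<Rightarrow> bool" where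
  "minimal_dominating_set G S \<longleftrightarrow>
     dominating_set G S \<and> (\<forall>T. T \<subset> S \<longrightarrow> \<not> dominating_set G T)"

definition reconf_adj :: "'a pair_pre_digraph \<Rightarrow> 'a set \<Rightarrow> 'a set \<Rightarrow> bool" where
  "reconf_adj G M1 M2 \<longleftrightarrow>
     (\<exists>v. (M2 - M1 = {v} \<and> M1 - M2 \<subseteq> open_nbhd G v) \<or>
          (M1 - M2 = {v} \<and> M2 - M1 \<subseteq> open_nbhd G v))"

definition reconf_graph :: "'a pair_pre_digraph \<Rightarrow> 'a set pair_pre_digraph" where
  "reconf_graph G =
     \<lparr> pverts = {M. minimal_dominating_set G M},
       parcs = {(M1, M2). minimal_dominating_set G M1 \<and> minimal_dominating_set G M2 \<and>
                          reconf_adj G M1 M2} \<rparr>"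

definition graph_join ::
    "'a pair_pre_digraph \<Rightarrow> 'b pair_pre_digraph \<Rightarrow> ('a + 'b) pair_pre_digraph" where
  "graph_join A B =
     \<lparr> pverts = pverts A <+> pverts B,
       parcs = {(Inl a, Inl a') | a a'. (a, a') \<in> parcs A} \<union>
               {(Inr b, Inr b') | b b'. (b, b') \<in> parcs B} \<union>
               {(Inl a, Inr b) | a b. a \<in> pverts A \<and> b \<in> pverts B} \<union>
               {(Inr b, Inl a) | a b. a \<in> pverts A \<and> b \<in> pverts B} \<rparr>"

lemma pair_graphI:
  assumes "finite (pverts G)" "parcs G \<subseteq> pverts G \<times> pverts G"
    and "sym (parcs G)" "\<And>v. (v, v) \<notin> parcs G"
  shows "pair_graph G"
proof -
  have "finite (parcs G)"
    using assms(1,2) by (meson finite_SigmaI finite_subset)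
  then show ?thesis
    using assms by unfold_locales (auto simp: symmetric_def)
qed

lemma pair_graph_reconf_graph:
  assumes "pair_graph G"
  shows "pair_graph (reconf_graph G)"
proof (rule pair_graphI)
  interpret pair_graph G by fact
  have "{M. minimal_dominating_set G M} \<subseteq> Pow (pverts G)"
    by (auto simp: minimal_dominating_set_def dominating_set_def)
  then show "finite (pverts (reconf_graph G))"
    using pair_finite_verts by (simp add: reconf_graph_def finite_subset)
qed (auto simp: reconf_graph_def reconf_adj_def sym_def)

lemma pair_graph_graph_join:
  assumes "pair_graph A" "pair_graph B"
  shows "pair_graph (graph_join A B)"
proof (rule pair_graphI)
  interpret A: pair_graph A by fact
  interpret B: pair_graph B by fact
  show "finite (pverts (graph_join A B))"
    using A.pair_finite_verts B.pair_finite_verts by (simp add: graph_join_def)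
  show "parcs (graph_join A B) \<subseteq> pverts (graph_join A B) \<times> pverts (graph_join A B)"
    using A.wellformed' B.wellformed' by (auto simp: graph_join_def)
  show "sym (parcs (graph_join A B))"
    using A.arcs_symmetric B.arcs_symmetric by (auto simp: graph_join_def sym_def)
  show "(v, v) \<notin> parcs (graph_join A B)" for v
    using A.no_loops' B.no_loops' by (auto simp: graph_join_def)
qed

end

theory Submission
  imports Defs
begin

text \<open>
  The apex \<open>k\<close> of \<open>G \<or> K\<^sub>1\<close> dominates everything on its own, so \<open>{k}\<close> is a minimal dominating set
  and the only one containing \<open>k\<close>. A nonempty set of vertices of \<open>G\<close> dominates \<open>k\<close> for free, so the
  remaining minimal dominating sets are those of \<open>G\<close>. Moving between \<open>{k}\<close> and any of them adds or
  removes just \<open>k\<close>, which is adjacent to all of \<open>G\<close>; hence \<open>{k}\<close> is the apex of the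
  reconfiguration graph.
\<close>

text \<open>Arcs here are pairs of vertices, so a vertex bijection \<open>f\<close> that preserves
  and reflects arcs already determines the arc map, namely \<open>map_prod f f\<close>.\<close>

lemma digraph_iso_with_projI:
  assumes "pair_wf_digraph G" "pair_wf_digraph H"
    and bij: "bij_betw f (pverts G) (pverts H)"
    and arcs: "\<And>u v. u \<in> pverts G \<Longrightarrow> v \<in> pverts G \<Longrightarrow>
                 (f u, f v) \<in> parcs H \<longleftrightarrow> (u, v) \<in> parcs G"
  shows "digraph_iso (with_proj G) (with_proj H)"
proof -
  interpret G: pair_wf_digraph G by fact
  interpret H: pair_wf_digraph H by fact
  define hom where "hom = \<lparr>iso_verts = f, iso_arcs = map_prod f f, iso_head = snd, iso_tail = fst\<rparr>"
  have inj: "inj_on f (pverts G)" and img: "pverts H = f ` pverts G"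
    using bij by (auto simp: bij_betw_def)
  have "inj_on (map_prod f f) (parcs G)"
    by (rule inj_on_subset[OF map_prod_inj_on[OF inj inj]]) (auto dest: G.wellformed')
  then have "pre_digraph.digraph_isomorphism (with_proj G) hom"
    using inj G.wf_digraph_axioms by (auto simp: pre_digraph.digraph_isomorphism_def hom_def)
  moreover have "parcs H = map_prod f f ` parcs G"
  proof
    show "parcs H \<subseteq> map_prod f f ` parcs G"
    proof
      fix e assume e: "e \<in> parcs H"
      then obtain u v where "u \<in> pverts G" "v \<in> pverts G" "e = (f u, f v)"
        using img by (metis H.wellformed' imageE surj_pair)
      with e arcs show "e \<in> map_prod f f ` parcs G"
        by (metis map_prod_imageI)
    qed
    show "map_prod f f ` parcs G \<subseteq> parcs H"
      using arcs by (auto dest: G.wellformed')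
  qed
  then have "with_proj H = app_iso hom (with_proj G)"
    by (simp add: with_proj_def app_iso_def hom_def img)
  ultimately show ?thesis
    unfolding digraph_iso_def by blast
qed

lemma digraph_iso_sym:
  assumes "digraph_iso G H"
  shows "digraph_iso H G"
proof -
  obtain hom where hom: "pre_digraph.digraph_isomorphism G hom" and H: "H = app_iso hom G"
    using assms by (auto simp: digraph_iso_def)
  then have "wf_digraph G"
    by (simp add: pre_digraph.digraph_isomorphism_def)
  from wf_digraph.digraph_isomorphism_invI[OF this hom] pre_digraph.app_iso_inv[OF hom]
  show ?thesis
    unfolding digraph_iso_def H by metis
qed

text \<open>A set of vertices of \<open>G\<close> dominates the apex exactly when it is nonempty.
  Dominating sets of a nonempty graph are nonempty; for an empty \<open>G\<close> the empty set
  would dominate \<open>G\<close> but not the apex.\<close>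

lemma dominating_set_join_Inl:
  assumes "pverts G \<noteq> {}" and "pverts K = {k}"
  shows "dominating_set (graph_join G K) (Inl ` M) \<longleftrightarrow> dominating_set G M"
proof -
  have "M \<noteq> {}" if "dominating_set G M"
    using that assms(1) by (auto simp: dominating_set_def)
  moreover have "dominating_set (graph_join G K) (Inl ` M) \<longleftrightarrow> dominating_set G M \<and> M \<noteq> {}"
    using assms by (auto simp: dominating_set_def graph_join_def)
  ultimately show ?thesis
    by blast
qed

lemma dominating_set_join_Inr:
  assumes "pverts K = {k}" and "Inr k \<in> S" and "S \<subseteq> pverts (graph_join G K)"
  shows "dominating_set (graph_join G K) S"
  using assms unfolding dominating_set_def graph_join_def by auto

text \<open>Proper subsets of a left copy are left copies of proper subsets, so minimality transfers
  together with domination.\<close>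

lemma minimal_dominating_set_join_Inl:
  assumes "pverts G \<noteq> {}" and "pverts K = {k}"
  shows "minimal_dominating_set (graph_join G K) (Inl ` M) \<longleftrightarrow> minimal_dominating_set G M"
proof -
  have psub: "T \<subset> Inl ` M \<longleftrightarrow> (\<exists>T'. T = Inl ` T' \<and> T' \<subset> M)" for T :: "('a + 'b) set"
    unfolding psubset_eq subset_image_iff by (auto simp: inj_image_eq_iff)
  show ?thesis
    using dominating_set_join_Inl[OF assms]
    by (auto simp: minimal_dominating_set_def psub)
qed

lemma minimal_dominating_set_join_Inr:
  assumes "pverts G \<noteq> {}" and "pverts K = {k}" and "Inr k \<in> S"
  shows "minimal_dominating_set (graph_join G K) S \<longleftrightarrow> S = {Inr k}"
proof
  have dom: "dominating_set (graph_join G K) {Inr k}"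
    using assms(2) by (intro dominating_set_join_Inr) (auto simp: graph_join_def)
  show "S = {Inr k}" if "minimal_dominating_set (graph_join G K) S"
    using that dom assms(3) by (auto simp: minimal_dominating_set_def)
  \<comment> \<open>The empty set is the only proper subset of \<open>{Inr k}\<close>, hence the
    only competitor for minimality.\<close>
  have "\<not> dominating_set (graph_join G K) {}"
    using assms(1) by (auto simp: dominating_set_def graph_join_def)
  then show "minimal_dominating_set (graph_join G K) S" if "S = {Inr k}"
    using dom that by (auto simp: minimal_dominating_set_def subset_singleton_iff psubset_eq)
qed

lemma minimal_dominating_sets_join:
  assumes "pverts G \<noteq> {}" and "pverts K = {k}"
  shows "{S. minimal_dominating_set (graph_join G K) S} =
           insert {Inr k} ((`) Inl ` {M. minimal_dominating_set G M})"
proof -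
  have "S = {Inr k} \<or> S \<in> (`) Inl ` {M. minimal_dominating_set G M}"
    if S: "minimal_dominating_set (graph_join G K) S" for S
  proof (cases "Inr k \<in> S")
    case True
    then show ?thesis
      using S minimal_dominating_set_join_Inr[OF assms] by blast
  next
    case False
    have "S \<subseteq> pverts G <+> {k}"
      using S assms(2) by (auto simp: minimal_dominating_set_def dominating_set_def graph_join_def)
    \<comment> \<open>Without the apex, \<open>S\<close> lies in the left copy, so its preimage is
      the required set in \<open>G\<close>.\<close>
    then have "S = Inl ` (Inl -` S)"
      using False by auto
    then show ?thesis
      using S minimal_dominating_set_join_Inl[OF assms] by (metis imageI mem_Collect_eq)
  qed
  then show ?thesis
    using minimal_dominating_set_join_Inr[OF assms] minimal_dominating_set_join_Inl[OF assms]
    by auto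
qed

text \<open>\<open>Inl\<close> commutes with set difference, and both differences lie in the left
  copy. The pivot of a move is therefore a vertex of \<open>G\<close>, whose neighbours in the left
  copy are those it has in \<open>G\<close>.\<close>

lemma reconf_adj_join_Inl:
  "reconf_adj (graph_join G K) (Inl ` M) (Inl ` N) \<longleftrightarrow> reconf_adj G M N"
proof -
  have sub: "Inl ` A \<subseteq> open_nbhd (graph_join G K) (Inl v) \<longleftrightarrow> A \<subseteq> open_nbhd G v" for A v
    by (auto simp: open_nbhd_def graph_join_def)
  have sing: "Inl ` A = {w} \<longleftrightarrow> (\<exists>v. w = Inl v \<and> A = {v})" for A :: "'a set" and w :: "'a + 'b"
    by (cases w) auto
  show ?thesis
    unfolding reconf_adj_def image_set_diff[OF inj_Inl, symmetric] sing
    using sub by blast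
qed

text \<open>The apex is the pivot in both directions: one difference is \<open>{Inr k}\<close>, the
  other is all of the copy of \<open>M\<close>, which consists of neighbours of the apex.\<close>

lemma reconf_adj_join_Inr:
  assumes "pverts K = {k}" and "M \<subseteq> pverts G"
  shows "reconf_adj (graph_join G K) {Inr k} (Inl ` M)"
    and "reconf_adj (graph_join G K) (Inl ` M) {Inr k}"
proof -
  have "{Inr k} - Inl ` M = {Inr k}" "Inl ` M - {Inr k} = Inl ` M"
    by auto
  moreover have "Inl ` M \<subseteq> open_nbhd (graph_join G K) (Inr k)"
    using assms by (auto simp: open_nbhd_def graph_join_def)
  ultimately show "reconf_adj (graph_join G K) {Inr k} (Inl ` M)"
    and "reconf_adj (graph_join G K) (Inl ` M) {Inr k}"
    unfolding reconf_adj_def by metis+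
qed

text \<open>Both differences are empty, so neither is a singleton. This settles the pair
  \<open>u = v = Inr k\<close> below, where the join has no loop.\<close>

lemma reconf_adj_irrefl: "\<not> reconf_adj G M M"
  by (simp add: reconf_adj_def)

theorem theorem3:
  fixes G :: "'a pair_pre_digraph" and K :: "'b pair_pre_digraph"
  assumes "pair_graph G"
    and "pverts G \<noteq> {}"
    and "complete_digraph 1 (with_proj K)"
  shows "digraph_iso (with_proj (reconf_graph (graph_join G K)))
                     (with_proj (graph_join (reconf_graph G) K))"
proof -
  obtain k where k: "pverts K = {k}" and no_arcs: "parcs K = {}"
    using assms(3) by (auto simp: complete_digraph_pair_def card_1_singleton_iff)
  let ?R = "reconf_graph (graph_join G K)" and ?J = "graph_join (reconf_graph G) K"
  have K: "pair_graph K"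
    using assms(3) by (rule pair_graphI_complete)
  have wf: "pair_wf_digraph ?J" "pair_wf_digraph ?R"
    using pair_graph_graph_join[OF pair_graph_reconf_graph[OF assms(1)] K]
      pair_graph_reconf_graph[OF pair_graph_graph_join[OF assms(1) K]]
    by (auto simp: pair_graph_def pair_digraph_def pair_fin_digraph_def)
  \<comment> \<open>Starting from the join, the map is a plain case distinction on the sum type;
    \<open>digraph_iso_sym\<close> reverses the direction at the end.\<close>
  define f :: "'a set + 'b \<Rightarrow> ('a + 'b) set"
    where "f = case_sum ((`) Inl) (\<lambda>b. {Inr b})"
  have f_simps: "f (Inl M) = Inl ` M" "f (Inr b) = {Inr b}" for M b
    by (simp_all add: f_def)
  have mds_Inl: "minimal_dominating_set (graph_join G K) (Inl ` M) \<longleftrightarrow> minimal_dominating_set G M" for M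
    by (rule minimal_dominating_set_join_Inl[OF assms(2) k])
  have mds_Inr: "minimal_dominating_set (graph_join G K) {Inr k}"
    using minimal_dominating_set_join_Inr[OF assms(2) k] by blast
  have verts_J: "pverts ?J = insert (Inr k) (Inl ` {M. minimal_dominating_set G M})"
    by (auto simp: graph_join_def reconf_graph_def k)
  have "inj_on f (pverts ?J)"
    by (auto simp: inj_on_def verts_J f_simps inj_image_eq_iff)
  moreover have "f ` pverts ?J = pverts ?R"
    using minimal_dominating_sets_join[OF assms(2) k]
    unfolding verts_J by (simp add: f_simps reconf_graph_def image_image)
  ultimately have "bij_betw f (pverts ?J) (pverts ?R)"
    by (simp add: bij_betw_def)
  moreover have "(f u, f v) \<in> parcs ?R \<longleftrightarrow> (u, v) \<in> parcs ?J"
    if "u \<in> pverts ?J" "v \<in> pverts ?J" for u v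
  proof -
    have sub: "minimal_dominating_set G M \<Longrightarrow> M \<subseteq> pverts G" for M
      by (simp add: minimal_dominating_set_def dominating_set_def)
    \<comment> \<open>Four cases, according to which of \<open>u\<close> and \<open>v\<close> is the
      apex. The type instance of \<open>graph_join_def\<close> unfolds only the outer join
      \<open>?J\<close>; the join inside \<open>?R\<close> stays folded so that the adjacency lemmas
      apply.\<close>
    show ?thesis
      using that reconf_adj_join_Inr[OF k sub] unfolding verts_J
      by (auto simp: f_simps mds_Inl mds_Inr reconf_adj_join_Inl reconf_adj_irrefl
          reconf_graph_def graph_join_def[of "_ :: 'a set pair_pre_digraph"] k no_arcs)
  qed
  ultimately have "digraph_iso (with_proj ?J) (with_proj ?R)"
    by (rule digraph_iso_with_projI[OF wf])
  then show ?thesis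
    by (rule digraph_iso_sym)
qed

end
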